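(* Let $A,B>0$ be bounded linear operators on a Hilbert space $\mathcal{H}$ such that $sA\le B\le tA$ for some scalars $0<s\le t$. Let $v\in[0,1]$ and let $f_v(x)=\frac{(1-v)+vx}{x^v}$ for $x>0$. (i) If $t\le 1$, then $f_v(t)\,A\sharp_v B\le A\nabla_v B\le f_v(s)\,A\sharp_v B$. (ii) If $s\ge 1$, then $f_v(s)\,A\sharp_v B\le A\nabla_v B\le f_v(t)\,A\sharp_v B$.
   Context: Operators are bounded linear operators on a Hilbert space $\mathcal{H}$. $A\ge 0$ (positive) means $\langle Ax,x\rangle\ge 0$ for all $x\in\mathcal{H}$; $A>0$ (strictly positive) means $A$ is positive and invertible; for self-adjoint $A,B$, $A\le B$ means $B-A\ge 0$. For $A,B>0$ and $v\in[0,1]$: $A\nabla_v B=(1-v)A+vB$ and $A\sharp_v B=A^{1/2}\left(A^{-1/2}BA^{-1/2}\right)^v A^{1/2}$, with powers defined by the continuous functional calculus. *)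

theory Defs
  imports "HOL-Analysis.Analysis" "HOL-Computational_Algebra.Polynomial" "HOL-Library.Nonpos_Ints"
begin

class complex_vector = real_vector +
  fixes scaleC :: "complex \<Rightarrow> 'a \<Rightarrow> 'a"  (infixr "*\<^sub>C" 75)
  assumes scaleC_add_right: "c *\<^sub>C (x + y) = c *\<^sub>C x + c *\<^sub>C y"
    and scaleC_add_left: "(c + d) *\<^sub>C x = c *\<^sub>C x + d *\<^sub>C x"
    and scaleC_scaleC: "c *\<^sub>C d *\<^sub>C x = (c * d) *\<^sub>C x"
    and scaleC_of_real: "complex_of_real r *\<^sub>C x = r *\<^sub>R x"

text \<open>The inner product is linear in the first argument.\<close>

class complex_hilbert = complex_vector + banach +
  fixes cinner :: "'a \<Rightarrow> 'a \<Rightarrow> complex"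
  assumes cinner_commute: "cinner x y = cnj (cinner y x)"
    and cinner_add_left: "cinner (x + y) z = cinner x z + cinner y z"
    and cinner_scaleC_left: "cinner (c *\<^sub>C x) y = c * cinner x y"
    and cinner_self_nonneg: "cinner x x \<in> \<real>\<^sub>\<ge>\<^sub>0"
    and norm_eq_sqrt_cinner: "norm x = sqrt (Re (cinner x x))"

lemma norm_scaleC: "norm (c *\<^sub>C x) = cmod c * norm (x :: 'a::complex_hilbert)"
proof -
  have "cinner (c *\<^sub>C x) (c *\<^sub>C x) = c * (cnj c * cinner x x)"
    by (metis cinner_commute cinner_scaleC_left complex_cnj_mult complex_cnj_cnj)
  also have "\<dots> = complex_of_real ((cmod c)\<^sup>2) * cinner x x"
    by (metis complex_norm_square mult.assoc)
  finally have "Re (cinner (c *\<^sub>C x) (c *\<^sub>C x)) = (cmod c)\<^sup>2 * Re (cinner x x)"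
    by simp
  then show ?thesis
    by (simp add: norm_eq_sqrt_cinner real_sqrt_mult)
qed

text \<open>Operators live in the library's space of bounded real-linear maps, which supplies the
  operator norm and its topology; \<open>is_op\<close> singles out the complex-linear ones.\<close>

type_synonym 'a op = "'a \<Rightarrow>\<^sub>L 'a"

definition is_op :: "'a::complex_hilbert op \<Rightarrow> bool" where
  "is_op T \<longleftrightarrow> (\<forall>c x. T (c *\<^sub>C x) = c *\<^sub>C T x)"

definition op_selfadjoint :: "'a::complex_hilbert op \<Rightarrow> bool" where
  "op_selfadjoint T \<longleftrightarrow> is_op T \<and> (\<forall>x y. cinner (T x) y = cinner x (T y))"

definition op_invertible :: "'a::complex_hilbert op \<Rightarrow> bool" where
  "op_invertible T \<longleftrightarrow> (\<exists>S. is_op S \<and> S o\<^sub>L T = id_blinfun \<and> T o\<^sub>L S = id_blinfun)"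

definition op_pos :: "'a::complex_hilbert op \<Rightarrow> bool" where
  "op_pos T \<longleftrightarrow> is_op T \<and> (\<forall>x. cinner (T x) x \<in> \<real>\<^sub>\<ge>\<^sub>0)"

definition op_strict_pos :: "'a::complex_hilbert op \<Rightarrow> bool" where
  "op_strict_pos T \<longleftrightarrow> op_pos T \<and> op_invertible T"

definition op_le :: "'a::complex_hilbert op \<Rightarrow> 'a op \<Rightarrow> bool"  (infix "\<preceq>" 50) where
  "A \<preceq> B \<longleftrightarrow> op_selfadjoint A \<and> op_selfadjoint B \<and> op_pos (B - A)"

lift_definition scalar_op :: "complex \<Rightarrow> 'a::complex_hilbert op" is "\<lambda>c x. c *\<^sub>C x"
proof (rule bounded_linear_intro)
  fix c :: complex and x y :: 'a and r :: real
  show "c *\<^sub>C (x + y) = c *\<^sub>C x + c *\<^sub>C y" by (rule scaleC_add_right)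
  show "c *\<^sub>C r *\<^sub>R x = r *\<^sub>R c *\<^sub>C x"
    by (metis scaleC_of_real scaleC_scaleC mult.commute)
  show "norm (c *\<^sub>C x) \<le> norm x * cmod c" by (simp add: norm_scaleC mult.commute)
qed

definition op_spectrum :: "'a::complex_hilbert op \<Rightarrow> complex set" where
  "op_spectrum T = {z. \<not> op_invertible (T - scalar_op z)}"

definition op_power :: "'a::complex_hilbert op \<Rightarrow> nat \<Rightarrow> 'a op" where
  "op_power T n = ((\<lambda>S. T o\<^sub>L S) ^^ n) id_blinfun"

definition op_poly :: "real poly \<Rightarrow> 'a::complex_hilbert op \<Rightarrow> 'a op" where
  "op_poly p T = (\<Sum>i\<le>degree p. coeff p i *\<^sub>R op_power T i)"

text \<open>Continuous functional calculus of a self-adjoint \<open>T\<close> for real \<open>f\<close> continuous on the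
  spectrum: the operator norm limit of \<open>p n (T)\<close> for real polynomials \<open>p n\<close> tending to \<open>f\<close> uniformly
  on the spectrum. As \<open>T\<close> is self-adjoint, its spectrum is real and nothing is lost in passing
  to its real points. Outside this setting the value is unspecified.\<close>

definition cfc :: "(real \<Rightarrow> real) \<Rightarrow> 'a::complex_hilbert op \<Rightarrow> 'a op" where
  "cfc f T = (THE S. \<exists>p :: nat \<Rightarrow> real poly.
     uniform_limit {x. complex_of_real x \<in> op_spectrum T} (\<lambda>n. poly (p n)) f sequentially
     \<and> (\<lambda>n. op_poly (p n) T) \<longlonglongrightarrow> S)"

definition op_powr :: "'a::complex_hilbert op \<Rightarrow> real \<Rightarrow> 'a op" where
  "op_powr T r = cfc (\<lambda>x. x powr r) T"

definition arith_mean :: "real \<Rightarrow> 'a::complex_hilbert op \<Rightarrow> 'a op \<Rightarrow> 'a op" where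
  "arith_mean v A B = (1 - v) *\<^sub>R A + v *\<^sub>R B"

definition geom_mean :: "real \<Rightarrow> 'a::complex_hilbert op \<Rightarrow> 'a op \<Rightarrow> 'a op" where
  "geom_mean v A B =
     op_powr A (1/2) o\<^sub>L op_powr (op_powr A (-1/2) o\<^sub>L B o\<^sub>L op_powr A (-1/2)) v o\<^sub>L op_powr A (1/2)"

definition fv :: "real \<Rightarrow> real \<Rightarrow> real" where
  "fv v x = ((1 - v) + v * x) / x powr v"

end

theory Submission
  imports Defs "HOL-Computational_Algebra.Fundamental_Theorem_Algebra"
begin

text \<open>Put \<open>C = A\<^sup>-\<^sup>1\<^sup>/\<^sup>2 B A\<^sup>-\<^sup>1\<^sup>/\<^sup>2\<close>. The hypothesis \<open>sA \<le> B \<le> tA\<close> says that \<open>s \<le> C \<le> t\<close>, so the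
  spectrum of \<open>C\<close> lies in \<open>[s, t]\<close>. There the function \<open>f\<^sub>v\<close> is monotone, since 1 is not an interior
  point, and so \<open>(1 - v) + v x = f\<^sub>v(x) x\<^sup>v\<close> lies between the multiples of \<open>x\<^sup>v\<close> by the values of \<open>f\<^sub>v\<close>
  at the two end points. The functional calculus carries these scalar inequalities over to \<open>C\<close>, and
  conjugation by \<open>A\<^sup>1\<^sup>/\<^sup>2\<close> turns them into the assertion (\<open>mean_comparison\<close>).

  The functional calculus is defined by polynomials converging uniformly on the spectrum; that it is
  well defined, multiplicative and monotone rests on a single fact, \<open>op_poly_nonneg\<close>: for self-adjoint
  \<open>T\<close>, a real polynomial \<open>p\<close> that is nonnegative on the spectrum of \<open>T\<close> gives a positive \<open>p(T)\<close>. If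
  \<open>p(T)\<close> were not positive, the infimum \<open>m < 0\<close> of its numerical range would be in its spectrum
  (\<open>numerical_range_infimum_in_spectrum\<close>). Splitting \<open>p - m\<close> into real linear and quadratic factors
  shows that \<open>m\<close> would be a value of \<open>p\<close> on the spectrum of \<open>T\<close> (\<open>op_poly_invertible\<close>), which is
  impossible. Inverses of operators come from the Lax--Milgram argument
  (\<open>coercive_imp_op_invertible\<close>).\<close>

section \<open>The real part of the inner product\<close>

definition re_inner :: "'a::complex_hilbert \<Rightarrow> 'a \<Rightarrow> real" where
  "re_inner x y = Re (cinner x y)"

lemma re_inner_commute: "re_inner x y = re_inner y x"
  by (metis re_inner_def cinner_commute complex_cnj(1) complex.sel(1) cnj.sel(1))

lemma re_inner_add_left: "re_inner (x + y) z = re_inner x z + re_inner y z"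
  by (simp add: re_inner_def cinner_add_left)

lemma re_inner_scaleR_left: "re_inner (r *\<^sub>R x) y = r * re_inner x y"
  by (simp add: re_inner_def cinner_scaleC_left flip: scaleC_of_real)

lemma re_inner_add_right: "re_inner z (x + y) = re_inner z x + re_inner z y"
  by (metis re_inner_add_left re_inner_commute)

lemma re_inner_scaleR_right: "re_inner x (r *\<^sub>R y) = r * re_inner x y"
  by (metis re_inner_scaleR_left re_inner_commute)

lemma re_inner_self: "re_inner x x = (norm x)\<^sup>2"
  using cinner_self_nonneg[of x]
  by (simp add: norm_eq_sqrt_cinner re_inner_def complex_nonneg_Reals_iff)

lemma quadratic_nonneg_discriminant:
  fixes a b c :: real
  assumes "\<And>r. 0 \<le> a + 2 * r * b + r\<^sup>2 * c" and "0 \<le> c"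
  shows "b\<^sup>2 \<le> a * c"
proof (cases "c = 0")
  case True
  have "b = 0"
  proof (rule ccontr)
    assume "b \<noteq> 0"
    then show False using assms(1)[of "- (a + 1) / (2 * b)"] True by (simp add: field_simps)
  qed
  then show ?thesis using True by simp
next
  case False
  have "0 \<le> (a + 2 * (- b / c) * b + (- b / c)\<^sup>2 * c) * c"
    by (intro mult_nonneg_nonneg assms)
  also have "\<dots> = a * c - b\<^sup>2"
    using False by (simp add: field_simps power2_eq_square)
  finally show ?thesis by simp
qed

text \<open>The Cauchy--Schwarz inequality for the semi-inner product \<open>\<langle>Px, y\<rangle>\<close> of a positive \<open>P\<close>; for
  \<open>P = 1\<close> it is the usual one.\<close>

lemma positive_form_Cauchy_Schwarz:
  fixes P :: "'a::complex_hilbert op"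
  assumes sym: "\<And>x y. re_inner (P x) y = re_inner x (P y)"
    and pos: "\<And>x. 0 \<le> re_inner (P x) x"
  shows "(re_inner (P x) y)\<^sup>2 \<le> re_inner (P x) x * re_inner (P y) y"
proof (rule quadratic_nonneg_discriminant[OF _ pos])
  fix r :: real
  have "re_inner (P y) x = re_inner (P x) y"
    by (metis sym re_inner_commute)
  then show "0 \<le> re_inner (P x) x + 2 * r * re_inner (P x) y + r\<^sup>2 * re_inner (P y) y"
    using pos[of "x + r *\<^sub>R y"]
    by (simp add: blinfun.bilinear_simps re_inner_add_left re_inner_add_right
        re_inner_scaleR_left re_inner_scaleR_right power2_eq_square algebra_simps)
qed

lemma abs_re_inner_le: "\<bar>re_inner x y\<bar> \<le> norm x * norm y"
proof -
  have "(re_inner x y)\<^sup>2 \<le> (norm x * norm y)\<^sup>2"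
    using positive_form_Cauchy_Schwarz[of id_blinfun x y]
    by (simp add: re_inner_self power_mult_distrib)
  then show ?thesis
    by (metis abs_le_square_iff abs_mult abs_norm_cancel)
qed

lemma bounded_bilinear_re_inner: "bounded_bilinear re_inner"
proof
  show "\<exists>K. \<forall>a b. norm (re_inner a b) \<le> norm a * norm b * K"
    by (intro exI[of _ 1]) (simp add: abs_re_inner_le)
qed (simp_all add: re_inner_add_left re_inner_add_right re_inner_scaleR_left
      re_inner_scaleR_right)

interpretation re_inner: bounded_bilinear re_inner
  by (rule bounded_bilinear_re_inner)

lemma re_inner_apply_le:
  fixes T :: "'a::complex_hilbert op"
  shows "re_inner (T x) x \<le> norm T * (norm x)\<^sup>2"
proof -
  have "re_inner (T x) x \<le> norm (T x) * norm x"
    using abs_re_inner_le[of "T x" x] by simp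
  also have "\<dots> \<le> (norm T * norm x) * norm x"
    by (intro mult_right_mono norm_blinfun) simp
  finally show ?thesis by (simp add: power2_eq_square)
qed

lemma re_inner_apply_ge:
  fixes T :: "'a::complex_hilbert op"
  shows "- norm T * (norm x)\<^sup>2 \<le> re_inner (T x) x"
  using re_inner_apply_le[of "- T" x] by (simp add: blinfun.minus_left re_inner.minus_left)

section \<open>Self-adjoint, positive and invertible operators\<close>

lemma is_op_id: "is_op id_blinfun"
  by (simp add: is_op_def)

lemma is_op_add: "is_op S \<Longrightarrow> is_op T \<Longrightarrow> is_op (S + T)"
  by (simp add: is_op_def blinfun.add_left scaleC_add_right)

lemma is_op_scaleR: "is_op T \<Longrightarrow> is_op (r *\<^sub>R T)"
  unfolding is_op_def blinfun.scaleR_left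
  by (metis scaleC_of_real scaleC_scaleC mult.commute)

lemma is_op_diff: "is_op S \<Longrightarrow> is_op T \<Longrightarrow> is_op (S - T)"
  using is_op_add[of S "(-1) *\<^sub>R T"] is_op_scaleR[of T "-1"] by simp

lemma is_op_compose: "is_op S \<Longrightarrow> is_op T \<Longrightarrow> is_op (S o\<^sub>L T)"
  by (simp add: is_op_def)

text \<open>Complex linearity recovers the imaginary part of the inner product from its real part, by
  \<open>Im \<langle>x, y\<rangle> = Re \<langle>x, i y\<rangle>\<close>. Hence self-adjointness and positivity can be tested on \<open>re_inner\<close>.\<close>

lemma Im_cinner: "Im (cinner x y) = re_inner x (\<i> *\<^sub>C y)"
proof -
  have "cinner x (\<i> *\<^sub>C y) = cnj (\<i> * cinner y x)"
    by (metis cinner_commute cinner_scaleC_left)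
  also have "\<dots> = - \<i> * cinner x y"
    by (metis cinner_commute complex_cnj_i complex_cnj_mult)
  finally show ?thesis by (simp add: re_inner_def)
qed

lemma op_selfadjoint_iff:
  "op_selfadjoint T \<longleftrightarrow> is_op T \<and> (\<forall>x y. re_inner (T x) y = re_inner x (T y))"
proof (intro iffI conjI allI)
  assume T: "is_op T \<and> (\<forall>x y. re_inner (T x) y = re_inner x (T y))"
  have "cinner (T x) y = cinner x (T y)" for x y
  proof (rule complex_eqI)
    show "Re (cinner (T x) y) = Re (cinner x (T y))"
      using T by (simp add: re_inner_def)
    have "Im (cinner (T x) y) = re_inner x (T (\<i> *\<^sub>C y))"
      using T by (simp add: Im_cinner)
    also have "\<dots> = Im (cinner x (T y))"
      using T by (simp add: is_op_def Im_cinner)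
    finally show "Im (cinner (T x) y) = Im (cinner x (T y))" .
  qed
  then show "op_selfadjoint T" using T by (simp add: op_selfadjoint_def)
qed (auto simp: op_selfadjoint_def re_inner_def)

lemma op_pos_iff:
  assumes "op_selfadjoint T"
  shows "op_pos T \<longleftrightarrow> (\<forall>x. 0 \<le> re_inner (T x) x)"
proof -
  have "Im (cinner (T x) x) = 0" for x
  proof -
    have "cinner (T x) x = cnj (cinner (T x) x)"
      using assms by (metis op_selfadjoint_def cinner_commute)
    then show ?thesis by (metis Reals_cnj_iff complex_is_Real_iff)
  qed
  then show ?thesis
    using assms by (simp add: op_pos_def op_selfadjoint_def complex_nonneg_Reals_iff re_inner_def)
qed

lemma op_selfadjointD:
  assumes "op_selfadjoint T"
  shows "is_op T" and "re_inner (T x) y = re_inner x (T y)"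
  using assms by (auto simp: op_selfadjoint_iff)

lemma op_selfadjoint_id: "op_selfadjoint id_blinfun"
  by (simp add: op_selfadjoint_iff is_op_id)

lemma op_selfadjoint_add: "op_selfadjoint S \<Longrightarrow> op_selfadjoint T \<Longrightarrow> op_selfadjoint (S + T)"
  by (simp add: op_selfadjoint_iff is_op_add blinfun.add_left re_inner.add_left re_inner.add_right)

lemma op_selfadjoint_scaleR: "op_selfadjoint T \<Longrightarrow> op_selfadjoint (r *\<^sub>R T)"
  by (simp add: op_selfadjoint_iff is_op_scaleR blinfun.scaleR_left re_inner.scaleR_left
      re_inner.scaleR_right)

lemma op_selfadjoint_diff: "op_selfadjoint S \<Longrightarrow> op_selfadjoint T \<Longrightarrow> op_selfadjoint (S - T)"
  using op_selfadjoint_add[of S "(-1) *\<^sub>R T"] op_selfadjoint_scaleR[of T "-1"] by simp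

lemma op_selfadjoint_conjugate:
  "op_selfadjoint S \<Longrightarrow> op_selfadjoint T \<Longrightarrow> op_selfadjoint (S o\<^sub>L T o\<^sub>L S)"
  by (simp add: op_selfadjoint_iff is_op_compose)

lemma op_le_iff:
  assumes "op_selfadjoint S" "op_selfadjoint T"
  shows "S \<preceq> T \<longleftrightarrow> (\<forall>x. re_inner (S x) x \<le> re_inner (T x) x)"
  using assms
  by (simp add: op_le_def op_pos_iff op_selfadjoint_diff blinfun.diff_left re_inner.diff_left)

lemma op_invertible_compose:
  assumes "op_invertible S" "op_invertible T"
  shows "op_invertible (S o\<^sub>L T)"
proof -
  obtain S' T' where *: "is_op S'" "S' o\<^sub>L S = id_blinfun" "S o\<^sub>L S' = id_blinfun"
    "is_op T'" "T' o\<^sub>L T = id_blinfun" "T o\<^sub>L T' = id_blinfun"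
    using assms unfolding op_invertible_def by blast
  have "S' (S x) = x" "S (S' x) = x" "T' (T x) = x" "T (T' x) = x" for x
    using * by (metis blinfun_apply_blinfun_compose blinfun_apply_id_blinfun id_apply)+
  then show ?thesis
    unfolding op_invertible_def using *
    by (intro exI[of _ "T' o\<^sub>L S'"]) (auto intro!: blinfun_eqI simp: is_op_compose)
qed

lemma op_invertible_scaleR_id:
  assumes "r \<noteq> 0" shows "op_invertible (r *\<^sub>R id_blinfun)"
  unfolding op_invertible_def using assms
  by (intro exI[of _ "(1 / r) *\<^sub>R id_blinfun"])
    (auto intro!: blinfun_eqI is_op_scaleR is_op_id simp: blinfun.scaleR_left)

text \<open>The Lax--Milgram argument: \<open>Px = y\<close> says that \<open>x\<close> is a fixed point of
  \<open>x \<mapsto> x + k(y - Px)\<close>. With \<open>N\<close> a bound of \<open>P\<close>, the square of the Lipschitz constant of this map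
  is at most \<open>1 - 2kc + k\<^sup>2N\<^sup>2\<close>, which is smallest, and below 1, at \<open>k = c / N\<^sup>2\<close>.\<close>

lemma coercive_imp_op_invertible:
  fixes P :: "'a::complex_hilbert op"
  assumes "is_op P" and "0 < c" and coer: "\<And>x. c * (norm x)\<^sup>2 \<le> re_inner (P x) x"
  shows "op_invertible P"
proof -
  have below: "c * norm x \<le> norm (P x)" for x
  proof (cases "x = 0")
    case False
    have "c * (norm x)\<^sup>2 \<le> norm (P x) * norm x"
      using coer[of x] abs_re_inner_le[of "P x" x] by simp
    then show ?thesis using False by (simp add: power2_eq_square)
  qed simp
  (* Adding c ensures c \<le> N, so that the square root in \<rho> is of a nonnegative number. *)
  define N where "N = norm P + c"
  define k where "k = c / N\<^sup>2"
  define \<rho> where "\<rho> = sqrt (1 - c\<^sup>2 / N\<^sup>2)"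
  have N: "0 < N" "c \<le> N" "norm P \<le> N" using \<open>0 < c\<close> by (simp_all add: N_def add_nonneg_pos)
  have \<rho>2: "0 \<le> 1 - c\<^sup>2 / N\<^sup>2" "1 - c\<^sup>2 / N\<^sup>2 < 1"
    using N \<open>0 < c\<close> by (auto simp: field_simps power_mono)
  then have \<rho>: "0 \<le> \<rho>" "\<rho> < 1" by (simp_all add: \<rho>_def)
  have contr: "norm (x - k *\<^sub>R P x) \<le> \<rho> * norm x" for x
  proof -
    have "(norm (P x))\<^sup>2 \<le> (N * norm x)\<^sup>2"
      using N(3) norm_blinfun[of P x] by (meson mult_right_mono norm_ge_zero order_trans power_mono)
    then have PN: "k\<^sup>2 * (norm (P x))\<^sup>2 \<le> k\<^sup>2 * (N * norm x)\<^sup>2"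
      by (intro mult_left_mono) auto
    have ck: "2 * k * (c * (norm x)\<^sup>2) \<le> 2 * k * re_inner (P x) x"
      using coer[of x] \<open>0 < c\<close> by (intro mult_left_mono) (auto simp: k_def)
    have "(norm (x - k *\<^sub>R P x))\<^sup>2 = re_inner (x - k *\<^sub>R P x) (x - k *\<^sub>R P x)"
      by (simp add: re_inner_self)
    also have "\<dots> = (norm x)\<^sup>2 - 2 * k * re_inner (P x) x + k\<^sup>2 * (norm (P x))\<^sup>2"
      by (simp add: re_inner.diff_left re_inner.diff_right re_inner.scaleR_left
          re_inner.scaleR_right re_inner_commute[of x "P x"] power2_eq_square algebra_simps
          flip: re_inner_self[unfolded power2_eq_square])
    also have "\<dots> \<le> (norm x)\<^sup>2 - 2 * k * (c * (norm x)\<^sup>2) + k\<^sup>2 * (N * norm x)\<^sup>2"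
      using PN ck by linarith
    also have "\<dots> = (1 - c\<^sup>2 / N\<^sup>2) * (norm x)\<^sup>2"
      using N(1) by (simp add: k_def field_simps power2_eq_square)
    also have "\<dots> = (\<rho> * norm x)\<^sup>2"
      using \<rho>2 by (simp add: \<rho>_def power_mult_distrib)
    finally show ?thesis by (rule power2_le_imp_le) (use \<rho> in auto)
  qed
  have surj: "\<exists>x. P x = y" for y
  proof -
    have "\<exists>!x. x + k *\<^sub>R (y - P x) = x"
    proof (rule banach_fix_type[OF \<rho>], intro allI)
      fix x x'
      have "(x + k *\<^sub>R (y - P x)) - (x' + k *\<^sub>R (y - P x')) = (x - x') - k *\<^sub>R P (x - x')"
        by (simp add: blinfun.diff_right algebra_simps)
      then show "dist (x + k *\<^sub>R (y - P x)) (x' + k *\<^sub>R (y - P x')) \<le> \<rho> * dist x x'"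
        using contr[of "x - x'"] by (simp only: dist_norm)
    qed
    moreover have "k \<noteq> 0" using N \<open>0 < c\<close> by (simp add: k_def)
    ultimately show ?thesis by auto
  qed
  have inj: "x = x'" if "P x = P x'" for x x'
    using below[of "x - x'"] that \<open>0 < c\<close>
    by (simp add: blinfun.diff_right mult_le_0_iff)
  define R where "R = inv (blinfun_apply P)"
  have PR: "P (R y) = y" for y
    unfolding R_def using surj by (metis surj_f_inv_f surjI)
  have RP: "R (P x) = x" for x
    by (rule inj) (simp add: PR)
  have "bounded_linear R"
  proof (rule bounded_linear_intro)
    show "R (x + y) = R x + R y" for x y
      by (rule inj) (simp add: PR blinfun.add_right)
    show "R (r *\<^sub>R x) = r *\<^sub>R R x" for r x
      by (rule inj) (simp add: PR blinfun.scaleR_right)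
    show "norm (R x) \<le> norm x * (1 / c)" for x
      using below[of "R x"] \<open>0 < c\<close> by (simp add: PR field_simps)
  qed
  then have app: "blinfun_apply (Blinfun R) = R"
    by (rule bounded_linear_Blinfun_apply)
  have "R (z *\<^sub>C x) = z *\<^sub>C R x" for z x
    by (rule inj) (use \<open>is_op P\<close> in \<open>simp add: PR is_op_def\<close>)
  then show ?thesis
    unfolding op_invertible_def
    by (intro exI[of _ "Blinfun R"]) (auto simp: is_op_def app PR RP intro!: blinfun_eqI)
qed

text \<open>A partial converse. Boundedness below of \<open>P\<close> passes to its quadratic form because
  \<open>\<parallel>Px\<parallel>\<^sup>2 \<le> \<parallel>P\<parallel> \<langle>Px, x\<rangle>\<close>, the Cauchy--Schwarz inequality for the form of \<open>P\<close> at \<open>x\<close> and \<open>Px\<close>.\<close>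

lemma positive_op_invertible_imp_coercive:
  assumes sa: "op_selfadjoint P" and pos: "\<And>x. 0 \<le> re_inner (P x) x" and "op_invertible P"
  obtains c where "0 < c" "\<And>x. c * (norm x)\<^sup>2 \<le> re_inner (P x) x"
proof -
  obtain R where "R o\<^sub>L P = id_blinfun"
    using \<open>op_invertible P\<close> unfolding op_invertible_def by blast
  then have RP: "R (P x) = x" for x
    by (metis blinfun_apply_blinfun_compose blinfun_apply_id_blinfun id_apply)
  have form: "(norm (P x))\<^sup>2 \<le> norm P * re_inner (P x) x" for x
  proof (cases "P x = 0")
    case True
    then show ?thesis using pos[of x] by simp
  next
    case False
    have "((norm (P x))\<^sup>2)\<^sup>2 \<le> re_inner (P x) x * re_inner (P (P x)) (P x)"
      using positive_form_Cauchy_Schwarz[of P x "P x"] sa pos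
      by (simp add: op_selfadjoint_iff re_inner_self)
    also have "\<dots> \<le> re_inner (P x) x * (norm P * (norm (P x))\<^sup>2)"
      by (intro mult_left_mono re_inner_apply_le pos)
    finally have "(norm (P x))\<^sup>2 * (norm (P x))\<^sup>2
        \<le> (norm P * re_inner (P x) x) * (norm (P x))\<^sup>2"
      by (simp add: power2_eq_square mult_ac)
    then show ?thesis using False by (simp only: mult_le_cancel_right) simp
  qed
  define K where "K = (norm R)\<^sup>2 * norm P + 1"
  have K: "0 < K" by (simp add: K_def add_nonneg_pos)
  have "(1 / K) * (norm x)\<^sup>2 \<le> re_inner (P x) x" for x
  proof -
    have "(norm x)\<^sup>2 \<le> (norm R * norm (P x))\<^sup>2"
      using norm_blinfun[of R "P x"] by (intro power_mono) (simp_all add: RP)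
    also have "\<dots> \<le> (norm R)\<^sup>2 * (norm P * re_inner (P x) x)"
      using form[of x] by (simp add: power_mult_distrib mult_left_mono)
    also have "\<dots> \<le> K * re_inner (P x) x"
      using pos[of x] by (simp add: K_def algebra_simps)
    finally show ?thesis using K by (simp add: field_simps)
  qed
  then show thesis using K by (intro that[of "1 / K"]) auto
qed

section \<open>The real spectrum of a self-adjoint operator\<close>

definition real_spectrum :: "'a::complex_hilbert op \<Rightarrow> real set" where
  "real_spectrum T = {x. complex_of_real x \<in> op_spectrum T}"

lemma real_spectrum_iff:
  fixes T :: "'a::complex_hilbert op"
  shows "x \<in> real_spectrum T \<longleftrightarrow> \<not> op_invertible (T - x *\<^sub>R id_blinfun)"
proof -
  have "scalar_op (complex_of_real x) = (x *\<^sub>R id_blinfun :: 'a op)"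
    by (rule blinfun_eqI) (simp add: scalar_op.rep_eq scaleC_of_real blinfun.scaleR_left)
  then show ?thesis by (simp add: real_spectrum_def op_spectrum_def)
qed

lemma real_spectrum_subset_interval:
  assumes "is_op T"
    and lower: "\<And>x. a * (norm x)\<^sup>2 \<le> re_inner (T x) x"
    and upper: "\<And>x. re_inner (T x) x \<le> b * (norm x)\<^sup>2"
  shows "real_spectrum T \<subseteq> {a..b}"
proof
  fix r assume r: "r \<in> real_spectrum T"
  have "\<not> r < a"
  proof
    assume "r < a"
    have "op_invertible (T - r *\<^sub>R id_blinfun)"
    proof (rule coercive_imp_op_invertible)
      show "(a - r) * (norm x)\<^sup>2 \<le> re_inner ((T - r *\<^sub>R id_blinfun) x) x" for x
        using lower[of x] by (simp add: blinfun.diff_left blinfun.scaleR_left re_inner.diff_left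
            re_inner.scaleR_left re_inner_self algebra_simps)
    qed (use assms \<open>r < a\<close> in \<open>auto intro: is_op_diff is_op_scaleR is_op_id\<close>)
    then show False using r by (simp add: real_spectrum_iff)
  qed
  moreover have "\<not> b < r"
  proof
    assume "b < r"
    have "op_invertible (r *\<^sub>R id_blinfun - T)"
    proof (rule coercive_imp_op_invertible)
      show "(r - b) * (norm x)\<^sup>2 \<le> re_inner ((r *\<^sub>R id_blinfun - T) x) x" for x
        using upper[of x] by (simp add: blinfun.diff_left blinfun.scaleR_left re_inner.diff_left
            re_inner.scaleR_left re_inner_self algebra_simps)
    qed (use assms \<open>b < r\<close> in \<open>auto intro: is_op_diff is_op_scaleR is_op_id\<close>)
    then have "op_invertible ((-1) *\<^sub>R id_blinfun o\<^sub>L (r *\<^sub>R id_blinfun - T))"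
      by (intro op_invertible_compose op_invertible_scaleR_id) auto
    also have "(-1) *\<^sub>R id_blinfun o\<^sub>L (r *\<^sub>R id_blinfun - T) = T - r *\<^sub>R id_blinfun"
      by (rule blinfun_eqI) (simp add: blinfun.diff_left blinfun.scaleR_left blinfun.minus_left)
    finally show False using r by (simp add: real_spectrum_iff)
  qed
  ultimately show "r \<in> {a..b}" by auto
qed

text \<open>The infimum \<open>m\<close> of the numerical range lies in the spectrum: \<open>S - m\<close> is positive, and were
  it invertible it would be coercive, so that \<open>m\<close> could be enlarged. The hypothesis on \<open>e\<close> excludes
  the zero space, where every spectrum is empty.\<close>

lemma numerical_range_infimum_in_spectrum:
  fixes S :: "'a::complex_hilbert op" and e :: 'a
  assumes sa: "op_selfadjoint S" and e: "norm e = 1"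
  obtains m where "m \<in> real_spectrum S" "\<And>x. m * (norm x)\<^sup>2 \<le> re_inner (S x) x"
proof -
  define W where "W = {re_inner (S x) x | x. norm x = 1}"
  define m where "m = Inf W"
  have bdd: "bdd_below W"
  proof (rule bdd_belowI)
    fix w assume "w \<in> W"
    then obtain x where "w = re_inner (S x) x" "norm x = 1" by (auto simp: W_def)
    then show "- norm S \<le> w" using re_inner_apply_ge[of S x] by simp
  qed
  have "re_inner (S e) e \<in> W" unfolding W_def using e by blast
  then have ne: "W \<noteq> {}" by blast
  have m: "m * (norm x)\<^sup>2 \<le> re_inner (S x) x" for x
  proof (cases "x = 0")
    case False
    define u where "u = (1 / norm x) *\<^sub>R x"
    have "norm u = 1" using False by (simp add: u_def)
    then have "re_inner (S u) u \<in> W" unfolding W_def by blast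
    then have "m \<le> re_inner (S u) u" unfolding m_def by (rule cInf_lower[OF _ bdd])
    also have "re_inner (S u) u = re_inner (S x) x / (norm x)\<^sup>2"
      by (simp add: u_def blinfun.scaleR_right re_inner.scaleR_left re_inner.scaleR_right
          power2_eq_square)
    finally show ?thesis using False by (simp add: field_simps)
  qed (simp add: re_inner.zero_left)
  have "m \<in> real_spectrum S"
    unfolding real_spectrum_iff
  proof
    assume inv: "op_invertible (S - m *\<^sub>R id_blinfun)"
    have sa': "op_selfadjoint (S - m *\<^sub>R id_blinfun)"
      by (intro op_selfadjoint_diff op_selfadjoint_scaleR op_selfadjoint_id sa)
    have form: "re_inner ((S - m *\<^sub>R id_blinfun) x) x = re_inner (S x) x - m * (norm x)\<^sup>2" for x
      by (simp add: blinfun.diff_left blinfun.scaleR_left re_inner.diff_left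
          re_inner.scaleR_left re_inner_self)
    obtain c where c: "0 < c"
      "\<And>x. c * (norm x)\<^sup>2 \<le> re_inner ((S - m *\<^sub>R id_blinfun) x) x"
      by (rule positive_op_invertible_imp_coercive[OF sa' _ inv]) (use m in \<open>auto simp: form\<close>)
    have "m + c \<le> Inf W"
    proof (rule cInf_greatest[OF ne])
      fix w assume "w \<in> W"
      then obtain x where "w = re_inner (S x) x" "norm x = 1" by (auto simp: W_def)
      then show "m + c \<le> w" using c(2)[of x] by (simp add: form)
    qed
    then show False using c(1) by (simp add: m_def)
  qed
  then show thesis using m that by blast
qed

section \<open>Polynomials in an operator\<close>

lemma op_power_Suc: "op_power T (Suc n) = T o\<^sub>L op_power T n"
  by (simp add: op_power_def)

lemma op_poly_eq_sum:
  assumes "degree p \<le> n"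
  shows "op_poly p T = (\<Sum>i\<le>n. coeff p i *\<^sub>R op_power T i)"
  unfolding op_poly_def
  by (rule sum.mono_neutral_left) (use assms in \<open>auto simp: coeff_eq_0\<close>)

lemma op_poly_pCons: "op_poly (pCons a p) T = a *\<^sub>R id_blinfun + (T o\<^sub>L op_poly p T)"
proof -
  have "op_poly (pCons a p) T
      = (\<Sum>i\<le>Suc (degree p). coeff (pCons a p) i *\<^sub>R op_power T i)"
    by (rule op_poly_eq_sum) (rule degree_pCons_le)
  also have "\<dots> = a *\<^sub>R id_blinfun + (\<Sum>i\<le>degree p. coeff p i *\<^sub>R (T o\<^sub>L op_power T i))"
    by (subst sum.atMost_Suc_shift) (simp add: op_power_Suc, simp add: op_power_def)
  also have "(\<Sum>i\<le>degree p. coeff p i *\<^sub>R (T o\<^sub>L op_power T i)) = T o\<^sub>L op_poly p T"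
    unfolding op_poly_def
    by (simp add: bounded_bilinear.sum_right[OF bounded_bilinear_blinfun_compose]
        bounded_bilinear.scaleR_right[OF bounded_bilinear_blinfun_compose])
  finally show ?thesis .
qed

lemma op_poly_0: "op_poly 0 T = 0"
  by (simp add: op_poly_def)

lemma op_poly_const: "op_poly [:c:] T = c *\<^sub>R id_blinfun"
  by (simp add: op_poly_pCons op_poly_0)

lemma op_poly_linear: "op_poly [:a, b:] T = a *\<^sub>R id_blinfun + b *\<^sub>R T"
  by (rule blinfun_eqI)
    (simp add: op_poly_pCons op_poly_0 blinfun.bilinear_simps)

lemma op_poly_add: "op_poly (p + q) T = op_poly p T + op_poly q T"
proof -
  have "op_poly p T = (\<Sum>i\<le>max (degree p) (degree q). coeff p i *\<^sub>R op_power T i)"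
    "op_poly q T = (\<Sum>i\<le>max (degree p) (degree q). coeff q i *\<^sub>R op_power T i)"
    by (simp_all add: op_poly_eq_sum)
  moreover have "op_poly (p + q) T
      = (\<Sum>i\<le>max (degree p) (degree q). coeff (p + q) i *\<^sub>R op_power T i)"
    by (rule op_poly_eq_sum) (rule degree_add_le_max)
  ultimately show ?thesis by (simp add: scaleR_add_left sum.distrib)
qed

lemma op_poly_smult: "op_poly (smult c p) T = c *\<^sub>R op_poly p T"
proof -
  have "op_poly (smult c p) T = (\<Sum>i\<le>degree p. coeff (smult c p) i *\<^sub>R op_power T i)"
    by (rule op_poly_eq_sum) (rule degree_smult_le)
  then show ?thesis by (simp add: op_poly_def scaleR_sum_right)
qed

lemma op_poly_diff: "op_poly (p - q) T = op_poly p T - op_poly q T"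
  using op_poly_add[of p "smult (-1) q" T] op_poly_smult[of "-1" q T] by simp

lemma op_poly_mult: "op_poly (p * q) T = op_poly p T o\<^sub>L op_poly q T"
proof (induction p)
  case 0
  then show ?case by (simp add: op_poly_0)
next
  case (pCons a p)
  show ?case
    by (rule blinfun_eqI)
      (simp add: mult_pCons_left op_poly_add op_poly_smult op_poly_pCons pCons.IH
        blinfun.bilinear_simps)
qed

lemma op_poly_commute: "op_poly p T (T x) = T (op_poly p T x)"
proof -
  have "op_poly (p * [:0, 1:]) T = op_poly ([:0, 1:] * p) T"
    by (simp only: mult.commute)
  then have "op_poly p T o\<^sub>L T = T o\<^sub>L op_poly p T"
    unfolding op_poly_mult op_poly_linear by simp
  then show ?thesis by (metis blinfun_apply_blinfun_compose)
qed

lemma op_selfadjoint_op_poly: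
  assumes "op_selfadjoint T"
  shows "op_selfadjoint (op_poly p T)"
proof (induction p)
  case 0
  then show ?case
    using op_selfadjoint_scaleR[OF op_selfadjoint_id, of 0] by (simp add: op_poly_0)
next
  case (pCons a p)
  have "op_selfadjoint (T o\<^sub>L op_poly p T)"
    using assms pCons.IH by (simp add: op_selfadjoint_iff is_op_compose op_poly_commute)
  then show ?case
    unfolding op_poly_pCons by (intro op_selfadjoint_add op_selfadjoint_scaleR op_selfadjoint_id)
qed

section \<open>Positivity of polynomials on the spectrum\<close>

lemma poly_of_real_add:
  "poly (map_poly complex_of_real (p + q)) z
    = poly (map_poly complex_of_real p) z + poly (map_poly complex_of_real q) z"
proof -
  have "map_poly complex_of_real (p + q) = map_poly complex_of_real p + map_poly complex_of_real q"
    by (rule poly_eqI) (simp add: coeff_map_poly)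
  then show ?thesis by simp
qed

lemma poly_of_real_smult:
  "poly (map_poly complex_of_real (smult c p)) z = of_real c * poly (map_poly complex_of_real p) z"
proof -
  have "map_poly complex_of_real (smult c p) = smult (of_real c) (map_poly complex_of_real p)"
    by (rule poly_eqI) (simp add: coeff_map_poly)
  then show ?thesis by simp
qed

lemma poly_of_real_mult:
  "poly (map_poly complex_of_real (p * q)) z
    = poly (map_poly complex_of_real p) z * poly (map_poly complex_of_real q) z"
  by (induction p)
    (simp_all add: mult_pCons_left poly_of_real_add poly_of_real_smult map_poly_pCons algebra_simps)

lemma poly_of_real_of_real:
  "poly (map_poly complex_of_real p) (of_real x) = of_real (poly p x)"
  by (induction p) (simp_all add: map_poly_pCons)

text \<open>A complex root of a real polynomial yields a real factor: linear if the root is real, and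
  otherwise the quadratic with this root and its conjugate.\<close>

lemma real_poly_factor:
  fixes q :: "real poly"
  assumes "0 < degree q"
  obtains (linear) a r where "q = [:- a, 1:] * r"
  | (quadratic) a b r where "b \<noteq> 0" "q = ([:- a, 1:] * [:- a, 1:] + [:b\<^sup>2:]) * r"
proof -
  have "degree (map_poly complex_of_real q) = degree q"
    by (rule degree_map_poly) simp
  then obtain z where z: "poly (map_poly complex_of_real q) z = 0"
    using alg_closed_imp_poly_has_root[of "map_poly complex_of_real q"] assms by auto
  show thesis
  proof (cases "Im z = 0")
    case True
    then have "z = of_real (Re z)" by (simp add: complex_eq_iff)
    then have "poly q (Re z) = 0"
      using z poly_of_real_of_real[of q "Re z"] by simp
    then obtain r where "q = [:- Re z, 1:] * r"
      unfolding poly_eq_0_iff_dvd by (auto elim: dvdE)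
    then show ?thesis by (rule linear)
  next
    case False
    define d where "d = [:- Re z, 1:] * [:- Re z, 1:] + [:(Im z)\<^sup>2:]"
    have d: "d = [:(Re z)\<^sup>2 + (Im z)\<^sup>2, - 2 * Re z, 1:]"
      by (simp add: d_def power2_eq_square)
    have "poly (map_poly complex_of_real d) z = 0"
      by (simp add: d map_poly_pCons complex_eq_iff power2_eq_square algebra_simps)
    moreover have "q = d * (q div d) + q mod d" by simp
    ultimately have rem0: "poly (map_poly complex_of_real (q mod d)) z = 0"
      using z by (metis poly_of_real_add poly_of_real_mult mult_zero_left add_0)
    have "degree (q mod d) \<le> 1"
      using degree_mod_less[of d q] by (auto simp: d)
    then have "q mod d = [:coeff (q mod d) 0, coeff (q mod d) 1:]"
      by (intro poly_eqI) (auto simp: coeff_pCons coeff_eq_0 split: nat.split)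
    then obtain u w where rem: "q mod d = [:u, w:]" by blast
    have "u + w * Re z = 0 \<and> w * Im z = 0"
      using rem0 unfolding rem by (simp add: map_poly_pCons complex_eq_iff mult.commute)
    then have "q mod d = 0" using False by (auto simp: rem)
    then have "q = d * (q div d)" by (metis mult_div_mod_eq add.right_neutral)
    then show ?thesis unfolding d_def by (rule quadratic[OF False])
  qed
qed

text \<open>The half of the spectral mapping theorem that is needed. A linear factor \<open>T - a\<close> is
  invertible when \<open>a\<close> is not in the spectrum; a quadratic one, \<open>(T - a)\<^sup>2 + b\<^sup>2\<close>, is coercive
  because \<open>T - a\<close> is self-adjoint.\<close>

lemma op_poly_invertible:
  fixes T :: "'a::complex_hilbert op"
  assumes sa: "op_selfadjoint T" and "q \<noteq> 0" and "\<And>x. x \<in> real_spectrum T \<Longrightarrow> poly q x \<noteq> 0"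
  shows "op_invertible (op_poly q T)"
  using assms(2,3)
proof (induction "degree q" arbitrary: q rule: less_induct)
  case less
  have step: "op_invertible (op_poly q T)"
    if q: "q = d * r" and d: "0 < degree d" "op_invertible (op_poly d T)" for d r
  proof -
    have "r \<noteq> 0" "d \<noteq> 0" using less.prems(1) q by auto
    then have "degree r < degree q" using q d(1) by (simp add: degree_mult_eq)
    moreover have "poly r x \<noteq> 0" if "x \<in> real_spectrum T" for x
      using less.prems(2)[OF that] q by auto
    ultimately have "op_invertible (op_poly r T)"
      using less.hyps \<open>r \<noteq> 0\<close> by blast
    then show ?thesis unfolding q op_poly_mult by (rule op_invertible_compose[OF d(2)])
  qed
  show ?case
  proof (cases "degree q = 0")
    case True
    then obtain c where "q = [:c:]" by (rule degree_eq_zeroE)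
    then show ?thesis
      using less.prems(1) by (simp add: op_poly_const op_invertible_scaleR_id)
  next
    case False
    then have "0 < degree q" by simp
    then show ?thesis
    proof (cases rule: real_poly_factor)
      case (linear a r)
      have "poly q a = 0" by (simp add: linear)
      then have "a \<notin> real_spectrum T" using less.prems(2) by blast
      then have "op_invertible (op_poly [:- a, 1:] T)"
        by (simp add: real_spectrum_iff op_poly_linear)
      then show ?thesis by (intro step[OF linear]) auto
    next
      case (quadratic a b r)
      let ?L = "op_poly [:- a, 1:] T"
      have saL: "op_selfadjoint ?L" by (rule op_selfadjoint_op_poly[OF sa])
      have "op_invertible (op_poly ([:- a, 1:] * [:- a, 1:] + [:b\<^sup>2:]) T)"
      proof (rule coercive_imp_op_invertible)
        show "is_op (op_poly ([:- a, 1:] * [:- a, 1:] + [:b\<^sup>2:]) T)"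
          by (rule op_selfadjointD(1)[OF op_selfadjoint_op_poly[OF sa]])
        show "0 < b\<^sup>2" using quadratic(1) by simp
        show "b\<^sup>2 * (norm x)\<^sup>2
            \<le> re_inner (op_poly ([:- a, 1:] * [:- a, 1:] + [:b\<^sup>2:]) T x) x" for x
          unfolding op_poly_add op_poly_mult op_poly_const
          by (simp add: blinfun.add_left blinfun.scaleR_left re_inner.add_left
              re_inner.scaleR_left re_inner_self op_selfadjointD(2)[OF saL])
      qed
      then show ?thesis by (intro step[OF quadratic(2)]) auto
    qed
  qed
qed

text \<open>The infimum \<open>m\<close> of the numerical range of \<open>p(T)\<close> is in the spectrum of \<open>p(T)\<close>, so \<open>p - m\<close>
  has a zero in the spectrum of \<open>T\<close> and \<open>m\<close> is a value of \<open>p\<close> there. When \<open>p - m\<close> vanishes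
  identically, any point of the spectrum is such a zero, and there is one.\<close>

lemma op_poly_nonneg:
  fixes T :: "'a::complex_hilbert op"
  assumes sa: "op_selfadjoint T" and p: "\<And>x. x \<in> real_spectrum T \<Longrightarrow> 0 \<le> poly p x"
  shows "0 \<le> re_inner (op_poly p T x) x"
proof (cases "x = 0")
  case False
  define e where "e = (1 / norm x) *\<^sub>R x"
  have e: "norm e = 1" using False by (simp add: e_def)
  obtain m where m: "m \<in> real_spectrum (op_poly p T)"
    "\<And>x. m * (norm x)\<^sup>2 \<le> re_inner (op_poly p T x) x"
    by (rule numerical_range_infimum_in_spectrum[OF op_selfadjoint_op_poly[OF sa] e]) blast
  have "\<not> op_invertible (op_poly (p - [:m:]) T)"
    using m(1) by (simp add: real_spectrum_iff op_poly_diff op_poly_const)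
  then have "p - [:m:] = 0 \<or> (\<exists>y\<in>real_spectrum T. poly (p - [:m:]) y = 0)"
    using op_poly_invertible[OF sa] by blast
  moreover obtain y0 where "y0 \<in> real_spectrum T"
    by (rule numerical_range_infimum_in_spectrum[OF sa e]) blast
  ultimately obtain y where "y \<in> real_spectrum T" "poly (p - [:m:]) y = 0"
    by (metis poly_0)
  then have "0 \<le> m" using p[of y] by simp
  then have "0 \<le> m * (norm x)\<^sup>2" by simp
  also have "\<dots> \<le> re_inner (op_poly p T x) x" by (rule m(2))
  finally show ?thesis .
qed (simp add: re_inner.zero_right)

text \<open>Positivity for \<open>\<epsilon>\<^sup>2 - p\<^sup>2\<close> bounds \<open>\<parallel>p(T)x\<parallel>\<^sup>2 = \<langle>p(T)\<^sup>2x, x\<rangle>\<close>.\<close>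

lemma norm_op_poly_le:
  fixes T :: "'a::complex_hilbert op"
  assumes sa: "op_selfadjoint T" and "0 \<le> \<epsilon>"
    and p: "\<And>x. x \<in> real_spectrum T \<Longrightarrow> \<bar>poly p x\<bar> \<le> \<epsilon>"
  shows "norm (op_poly p T) \<le> \<epsilon>"
proof (rule norm_blinfun_bound[OF \<open>0 \<le> \<epsilon>\<close>])
  fix x
  have "0 \<le> poly ([:\<epsilon>\<^sup>2:] - p * p) y" if "y \<in> real_spectrum T" for y
  proof -
    have "(poly p y)\<^sup>2 \<le> \<epsilon>\<^sup>2"
      using p[OF that] \<open>0 \<le> \<epsilon>\<close> by (simp add: abs_le_square_iff[symmetric])
    then show ?thesis by (simp add: power2_eq_square)
  qed
  then have "0 \<le> re_inner (op_poly ([:\<epsilon>\<^sup>2:] - p * p) T x) x"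
    by (rule op_poly_nonneg[OF sa])
  also have "\<dots> = \<epsilon>\<^sup>2 * (norm x)\<^sup>2 - (norm (op_poly p T x))\<^sup>2"
    unfolding op_poly_diff op_poly_mult op_poly_const
    by (simp add: blinfun.diff_left blinfun.scaleR_left re_inner.diff_left re_inner.scaleR_left
        re_inner_self op_selfadjointD(2)[OF op_selfadjoint_op_poly[OF sa]])
  finally have "(norm (op_poly p T x))\<^sup>2 \<le> (\<epsilon> * norm x)\<^sup>2"
    by (simp add: power_mult_distrib)
  then show "norm (op_poly p T x) \<le> \<epsilon> * norm x"
    by (rule power2_le_imp_le) (use \<open>0 \<le> \<epsilon>\<close> in simp)
qed

section \<open>The continuous functional calculus\<close>

lemma uniform_limit_op_poly_diff:
  fixes p q :: "nat \<Rightarrow> real poly"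
  assumes sa: "op_selfadjoint T"
    and "uniform_limit (real_spectrum T) (\<lambda>n. poly (p n)) f sequentially"
    and "uniform_limit (real_spectrum T) (\<lambda>n. poly (q n)) f sequentially"
    and "0 < \<epsilon>"
  obtains N where "\<And>m n. N \<le> m \<Longrightarrow> N \<le> n \<Longrightarrow> norm (op_poly (p m) T - op_poly (q n) T) \<le> \<epsilon>"
proof -
  obtain N1 N2 where N1: "\<And>n x. N1 \<le> n \<Longrightarrow> x \<in> real_spectrum T \<Longrightarrow> dist (poly (p n) x) (f x) < \<epsilon> / 2"
    and N2: "\<And>n x. N2 \<le> n \<Longrightarrow> x \<in> real_spectrum T \<Longrightarrow> dist (poly (q n) x) (f x) < \<epsilon> / 2"
    using assms(2,3) \<open>0 < \<epsilon>\<close> unfolding uniform_limit_sequentially_iff by (meson half_gt_zero)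
  show thesis
  proof (rule that[of "max N1 N2"])
    fix m n assume mn: "max N1 N2 \<le> m" "max N1 N2 \<le> n"
    have "\<bar>poly (p m - q n) x\<bar> \<le> \<epsilon>" if "x \<in> real_spectrum T" for x
    proof -
      have "\<bar>poly (p m) x - f x\<bar> < \<epsilon> / 2" "\<bar>poly (q n) x - f x\<bar> < \<epsilon> / 2"
        using N1[of m x] N2[of n x] mn that unfolding dist_real_def by auto
      then show ?thesis unfolding poly_diff by linarith
    qed
    then show "norm (op_poly (p m) T - op_poly (q n) T) \<le> \<epsilon>"
      unfolding op_poly_diff[symmetric] using \<open>0 < \<epsilon>\<close> by (intro norm_op_poly_le[OF sa]) auto
  qed
qed

text \<open>By the norm estimate, operators \<open>p\<^sub>n(T)\<close> form a Cauchy sequence when the \<open>p\<^sub>n\<close> converge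
  uniformly on the spectrum, and their limit depends only on that of the \<open>p\<^sub>n\<close>. This makes the
  description in the definition of the functional calculus a unique one.\<close>

lemma cfc_tendsto:
  fixes T :: "'a::complex_hilbert op"
  assumes sa: "op_selfadjoint T"
    and p: "uniform_limit (real_spectrum T) (\<lambda>n. poly (p n)) f sequentially"
  shows "(\<lambda>n. op_poly (p n) T) \<longlonglongrightarrow> cfc f T"
proof -
  have "Cauchy (\<lambda>n. op_poly (p n) T)"
    unfolding Cauchy_def
  proof (intro allI impI)
    fix e :: real assume "0 < e"
    then obtain N where N: "\<And>m n. N \<le> m \<Longrightarrow> N \<le> n \<Longrightarrow>
        norm (op_poly (p m) T - op_poly (p n) T) \<le> e / 2"
      using uniform_limit_op_poly_diff[OF sa p p half_gt_zero[OF \<open>0 < e\<close>]] by blast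
    have "dist (op_poly (p m) T) (op_poly (p n) T) < e" if "N \<le> m" "N \<le> n" for m n
      using N[OF that] \<open>0 < e\<close> by (simp add: dist_norm)
    then show "\<exists>N. \<forall>m\<ge>N. \<forall>n\<ge>N. dist (op_poly (p m) T) (op_poly (p n) T) < e" by blast
  qed
  then obtain S where S: "(\<lambda>n. op_poly (p n) T) \<longlonglongrightarrow> S"
    by (metis Cauchy_convergent convergent_def)
  have unique: "S' = S"
    if q: "uniform_limit (real_spectrum T) (\<lambda>n. poly (q n)) f sequentially"
      and S': "(\<lambda>n. op_poly (q n) T) \<longlonglongrightarrow> S'" for q S'
  proof -
    have "(\<lambda>n. op_poly (q n) T - op_poly (p n) T) \<longlonglongrightarrow> 0"
    proof (rule LIMSEQ_I)
      fix e :: real assume "0 < e"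
      obtain N where "\<And>m n. N \<le> m \<Longrightarrow> N \<le> n \<Longrightarrow>
          norm (op_poly (q m) T - op_poly (p n) T) \<le> e / 2"
        using uniform_limit_op_poly_diff[OF sa q p half_gt_zero[OF \<open>0 < e\<close>]] by blast
      then have "\<forall>n\<ge>N. norm (op_poly (q n) T - op_poly (p n) T - 0) < e"
        using \<open>0 < e\<close> by (auto intro: le_less_trans[of _ "e / 2"])
      then show "\<exists>N. \<forall>n\<ge>N. norm (op_poly (q n) T - op_poly (p n) T - 0) < e" by blast
    qed
    moreover have "(\<lambda>n. op_poly (q n) T - op_poly (p n) T) \<longlonglongrightarrow> S' - S"
      by (rule tendsto_diff[OF S' S])
    ultimately show ?thesis using LIMSEQ_unique by force
  qed
  have "cfc f T = S"
    unfolding cfc_def real_spectrum_def[symmetric]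
    by (rule the_equality) (use p S unique in blast)+
  then show ?thesis using S by simp
qed

lemma cfc_cong:
  assumes "\<And>x. x \<in> real_spectrum T \<Longrightarrow> f x = g x"
  shows "cfc f T = cfc g T"
proof -
  have "uniform_limit (real_spectrum T) h f sequentially
      \<longleftrightarrow> uniform_limit (real_spectrum T) h g sequentially" for h :: "nat \<Rightarrow> real \<Rightarrow> real"
    by (rule uniform_limit_cong') (use assms in auto)
  then show ?thesis unfolding cfc_def real_spectrum_def[symmetric] by simp
qed

lemma cfc_poly:
  assumes "op_selfadjoint T"
  shows "cfc (poly p) T = op_poly p T"
proof -
  have "(\<lambda>n. op_poly p T) \<longlonglongrightarrow> cfc (poly p) T"
    by (rule cfc_tendsto[OF assms]) (rule uniform_limit_const)
  then show ?thesis by (simp add: LIMSEQ_const_iff)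
qed

lemma Weierstrass_poly:
  fixes f :: "real \<Rightarrow> real"
  assumes "continuous_on {a..b} f"
  obtains p :: "nat \<Rightarrow> real poly" where "uniform_limit {a..b} (\<lambda>n. poly (p n)) f sequentially"
proof -
  have "\<exists>q. \<forall>x\<in>{a..b}. \<bar>f x - poly q x\<bar> < e" if "0 < e" for e
  proof -
    obtain g where g: "real_polynomial_function g" "\<And>x. x \<in> {a..b} \<Longrightarrow> \<bar>f x - g x\<bar> < e"
      using Stone_Weierstrass_real_polynomial_function[OF compact_Icc assms \<open>0 < e\<close>] by blast
    obtain c n where "g = (\<lambda>x. \<Sum>i\<le>n. c i * x ^ i)"
      using g(1) unfolding real_polynomial_function_iff_sum by blast
    then have "g = poly (\<Sum>i\<le>n. monom (c i) i)"
      by (auto simp: poly_sum poly_monom)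
    then show ?thesis using g(2) by blast
  qed
  then have "\<forall>n. \<exists>q. \<forall>x\<in>{a..b}. \<bar>f x - poly q x\<bar> < inverse (real (Suc n))" by simp
  then obtain p where p: "\<And>n x. x \<in> {a..b} \<Longrightarrow> \<bar>f x - poly (p n) x\<bar> < inverse (real (Suc n))"
    by metis
  have "uniform_limit {a..b} (\<lambda>n. poly (p n)) f sequentially"
    unfolding uniform_limit_sequentially_iff
  proof (intro allI impI)
    fix e :: real assume "0 < e"
    then obtain N where N: "inverse (real (Suc N)) < e" using reals_Archimedean by blast
    have "dist (poly (p n) x) (f x) < e" if "N \<le> n" "x \<in> {a..b}" for n x
    proof -
      have "dist (poly (p n) x) (f x) < inverse (real (Suc n))"
        using p[OF that(2), of n] by (simp add: dist_real_def abs_minus_commute)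
      also have "\<dots> \<le> inverse (real (Suc N))" using that(1) by (simp add: le_imp_inverse_le)
      finally show ?thesis using N by simp
    qed
    then show "\<exists>N. \<forall>n\<ge>N. \<forall>x\<in>{a..b}. dist (poly (p n) x) (f x) < e" by blast
  qed
  then show thesis by (rule that)
qed

text \<open>Continuity is asked for on an interval around the spectrum, not on the spectrum alone, so that
  the classical Weierstrass theorem provides the approximating polynomials directly.\<close>

locale selfadjoint_on_interval =
  fixes T :: "'a::complex_hilbert op" and a b :: real
  assumes selfadjoint: "op_selfadjoint T"
    and spectrum: "real_spectrum T \<subseteq> {a..b}"
begin

lemma cfc_approx:
  assumes "continuous_on {a..b} f"
  obtains p where "uniform_limit (real_spectrum T) (\<lambda>n. poly (p n)) f sequentially"
    "(\<lambda>n. op_poly (p n) T) \<longlonglongrightarrow> cfc f T"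
proof -
  obtain p where "uniform_limit {a..b} (\<lambda>n. poly (p n)) f sequentially"
    using Weierstrass_poly[OF assms] .
  then have "uniform_limit (real_spectrum T) (\<lambda>n. poly (p n)) f sequentially"
    by (rule uniform_limit_on_subset[OF _ spectrum])
  then show thesis using cfc_tendsto[OF selfadjoint] that by blast
qed

lemma cfc_mult:
  assumes f: "continuous_on {a..b} f" and g: "continuous_on {a..b} g"
  shows "cfc (\<lambda>x. f x * g x) T = cfc f T o\<^sub>L cfc g T"
proof -
  obtain p where p: "uniform_limit (real_spectrum T) (\<lambda>n. poly (p n)) f sequentially"
    "(\<lambda>n. op_poly (p n) T) \<longlonglongrightarrow> cfc f T"
    using cfc_approx[OF f] .
  obtain q where q: "uniform_limit (real_spectrum T) (\<lambda>n. poly (q n)) g sequentially"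
    "(\<lambda>n. op_poly (q n) T) \<longlonglongrightarrow> cfc g T"
    using cfc_approx[OF g] .
  have bounded: "bounded (h ` real_spectrum T)" if "continuous_on {a..b} h" for h :: "real \<Rightarrow> real"
    by (rule bounded_subset[OF _ image_mono[OF spectrum]])
      (intro compact_imp_bounded compact_continuous_image that compact_Icc)
  have "uniform_limit (real_spectrum T) (\<lambda>n x. poly (p n) x * poly (q n) x) (\<lambda>x. f x * g x)
      sequentially"
    by (rule uniform_lim_mult[OF p(1) q(1) bounded[OF f] bounded[OF g]])
  then have "uniform_limit (real_spectrum T) (\<lambda>n. poly (p n * q n)) (\<lambda>x. f x * g x) sequentially"
    by (simp add: poly_mult[abs_def])
  then have "(\<lambda>n. op_poly (p n * q n) T) \<longlonglongrightarrow> cfc (\<lambda>x. f x * g x) T"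
    by (rule cfc_tendsto[OF selfadjoint])
  moreover have "(\<lambda>n. op_poly (p n * q n) T) \<longlonglongrightarrow> (cfc f T o\<^sub>L cfc g T)"
    unfolding op_poly_mult
    by (rule bounded_bilinear.tendsto[OF bounded_bilinear_blinfun_compose p(2) q(2)])
  ultimately show ?thesis by (rule LIMSEQ_unique)
qed

lemma cfc_scaleR:
  assumes "continuous_on {a..b} f"
  shows "cfc (\<lambda>x. c * f x) T = c *\<^sub>R cfc f T"
proof -
  have "cfc (\<lambda>x. poly [:c:] x * f x) T = cfc (poly [:c:]) T o\<^sub>L cfc f T"
    by (rule cfc_mult[OF _ assms]) (intro continuous_intros)
  also have "\<dots> = c *\<^sub>R cfc f T"
    by (rule blinfun_eqI) (simp add: cfc_poly[OF selfadjoint] op_poly_const blinfun.scaleR_left)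
  finally show ?thesis by simp
qed

lemma op_selfadjoint_cfc:
  assumes "continuous_on {a..b} f"
  shows "op_selfadjoint (cfc f T)"
proof -
  obtain p where p: "(\<lambda>n. op_poly (p n) T) \<longlonglongrightarrow> cfc f T"
    using cfc_approx[OF assms] by blast
  have sa: "op_selfadjoint (op_poly (p n) T)" for n
    by (rule op_selfadjoint_op_poly[OF selfadjoint])
  have lim: "(\<lambda>n. op_poly (p n) T x) \<longlonglongrightarrow> cfc f T x" for x
    by (intro tendsto_intros p)
  have "cfc f T (c *\<^sub>C x) = c *\<^sub>C cfc f T x" for c x
  proof (rule LIMSEQ_unique[OF lim])
    have "(\<lambda>n. scalar_op c (op_poly (p n) T x)) \<longlonglongrightarrow> scalar_op c (cfc f T x)"
      by (intro tendsto_intros lim)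
    then show "(\<lambda>n. op_poly (p n) T (c *\<^sub>C x)) \<longlonglongrightarrow> c *\<^sub>C cfc f T x"
      using op_selfadjointD(1)[OF sa] by (simp add: scalar_op.rep_eq is_op_def)
  qed
  moreover have "re_inner (cfc f T x) y = re_inner x (cfc f T y)" for x y
  proof (rule LIMSEQ_unique)
    show "(\<lambda>n. re_inner (op_poly (p n) T x) y) \<longlonglongrightarrow> re_inner (cfc f T x) y"
      by (intro re_inner.tendsto lim tendsto_const)
    show "(\<lambda>n. re_inner (op_poly (p n) T x) y) \<longlonglongrightarrow> re_inner x (cfc f T y)"
      unfolding op_selfadjointD(2)[OF sa] by (intro re_inner.tendsto lim tendsto_const)
  qed
  ultimately show ?thesis by (simp add: op_selfadjoint_iff is_op_def)
qed

text \<open>Approximating polynomials need not be ordered as their limits are, but they are up to an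
  additive error \<open>e\<close>, which is let tend to 0 after the limit has been taken.\<close>

lemma cfc_mono:
  assumes f: "continuous_on {a..b} f" and g: "continuous_on {a..b} g"
    and le: "\<And>x. x \<in> {a..b} \<Longrightarrow> f x \<le> g x"
  shows "re_inner (cfc f T x) x \<le> re_inner (cfc g T x) x"
proof -
  obtain p where p: "uniform_limit (real_spectrum T) (\<lambda>n. poly (p n)) f sequentially"
    "(\<lambda>n. op_poly (p n) T) \<longlonglongrightarrow> cfc f T"
    using cfc_approx[OF f] .
  obtain q where q: "uniform_limit (real_spectrum T) (\<lambda>n. poly (q n)) g sequentially"
    "(\<lambda>n. op_poly (q n) T) \<longlonglongrightarrow> cfc g T"
    using cfc_approx[OF g] .
  have approx: "re_inner (cfc f T x) x \<le> re_inner (cfc g T x) x + e * (norm x)\<^sup>2" if "0 < e" for e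
  proof (rule tendsto_le[OF sequentially_bot])
    show "(\<lambda>n. re_inner (op_poly (p n) T x) x) \<longlonglongrightarrow> re_inner (cfc f T x) x"
      by (intro re_inner.tendsto blinfun.tendsto p tendsto_const)
    show "(\<lambda>n. re_inner (op_poly (q n) T x) x + e * (norm x)\<^sup>2)
        \<longlonglongrightarrow> re_inner (cfc g T x) x + e * (norm x)\<^sup>2"
      by (intro tendsto_add re_inner.tendsto blinfun.tendsto q tendsto_const)
    have "\<forall>\<^sub>F n in sequentially. \<forall>y\<in>real_spectrum T. dist (poly (p n) y) (f y) < e / 2"
      "\<forall>\<^sub>F n in sequentially. \<forall>y\<in>real_spectrum T. dist (poly (q n) y) (g y) < e / 2"
      by (rule uniform_limitD[OF p(1) half_gt_zero[OF that]],
          rule uniform_limitD[OF q(1) half_gt_zero[OF that]])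
    then show "\<forall>\<^sub>F n in sequentially. re_inner (op_poly (p n) T x) x
        \<le> re_inner (op_poly (q n) T x) x + e * (norm x)\<^sup>2"
    proof eventually_elim
      case (elim n)
      have "0 \<le> poly (q n - p n + [:e:]) y" if y: "y \<in> real_spectrum T" for y
      proof -
        have "f y \<le> g y" using le spectrum y by blast
        moreover have "\<bar>poly (p n) y - f y\<bar> < e / 2" "\<bar>poly (q n) y - g y\<bar> < e / 2"
          using elim y by (auto simp: dist_real_def)
        ultimately have "0 \<le> poly (q n) y - poly (p n) y + e"
          unfolding abs_less_iff by linarith
        then show ?thesis by simp
      qed
      then have "0 \<le> re_inner (op_poly (q n - p n + [:e:]) T x) x"
        by (rule op_poly_nonneg[OF selfadjoint])
      then show ?case
        unfolding op_poly_add op_poly_diff op_poly_const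
        by (simp add: blinfun.bilinear_simps re_inner.add_left re_inner.diff_left
            re_inner.scaleR_left re_inner_self)
    qed
  qed
  show ?thesis
  proof (rule tendsto_lowerbound)
    show "((\<lambda>e. re_inner (cfc g T x) x + e * (norm x)\<^sup>2) \<longlongrightarrow> re_inner (cfc g T x) x)
        (at_right 0)"
      by (rule tendsto_eq_intros refl | simp)+
    show "\<forall>\<^sub>F e in at_right 0. re_inner (cfc f T x) x \<le> re_inner (cfc g T x) x + e * (norm x)\<^sup>2"
      using approx by (auto simp: eventually_at_right_less eventually_at_topological
          intro: eventually_mono[OF eventually_at_right_less])
  qed simp
qed

end

section \<open>The scalar function\<close>

text \<open>Up to a positive factor, \<open>f\<^sub>v\<close> has derivative \<open>v (1 - v) (x - 1)\<close>; for \<open>0 \<le> v \<le> 1\<close> it is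
  therefore antimonotone before 1 and monotone after it.\<close>

lemma fv_deriv:
  assumes "0 < x"
  shows "(fv v has_real_derivative v * (1 - v) * (x - 1) * x powr (- v - 1)) (at x)"
proof -
  have eq: "fv v = (\<lambda>x. ((1 - v) + v * x) * x powr (- v))"
    by (simp add: fun_eq_iff fv_def powr_minus divide_simps)
  have "x powr (- v) = x * x powr (- v - 1)"
    using assms by (simp add: powr_diff)
  then show ?thesis
    unfolding eq using assms
    by (auto intro!: derivative_eq_intros simp: algebra_simps)
qed

lemma fv_antimono:
  assumes "0 \<le> v" "v \<le> 1" "0 < x" "x \<le> y" "y \<le> 1"
  shows "fv v y \<le> fv v x"
proof (rule DERIV_nonpos_imp_nonincreasing[OF \<open>x \<le> y\<close>])
  fix z assume z: "x \<le> z" "z \<le> y"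
  have "v * (1 - v) * (z - 1) * z powr (- v - 1) \<le> 0"
    using assms z by (intro mult_nonpos_nonneg mult_nonneg_nonpos mult_nonneg_nonneg) auto
  moreover have "0 < z" using assms z by simp
  ultimately show "\<exists>d. (fv v has_real_derivative d) (at z) \<and> d \<le> 0"
    using fv_deriv by blast
qed

lemma fv_mono:
  assumes "0 \<le> v" "v \<le> 1" "1 \<le> x" "x \<le> y"
  shows "fv v x \<le> fv v y"
proof (rule DERIV_nonneg_imp_nondecreasing[OF \<open>x \<le> y\<close>])
  fix z assume z: "x \<le> z" "z \<le> y"
  have "0 \<le> v * (1 - v) * (z - 1) * z powr (- v - 1)"
    using assms z by (intro mult_nonneg_nonneg) auto
  moreover have "0 < z" using assms z by simp
  ultimately show "\<exists>d. (fv v has_real_derivative d) (at z) \<and> 0 \<le> d"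
    using fv_deriv by blast
qed

section \<open>From scalars to operator means\<close>

lemma continuous_on_powr_interval:
  fixes a b r :: real
  assumes "0 < a"
  shows "continuous_on {a..b} (\<lambda>x. x powr r)"
  by (intro continuous_intros) (use assms in auto)

text \<open>A lower bound \<open>c > 0\<close> of \<open>A\<close> keeps the spectrum away from 0, within an interval on which
  \<open>x\<^sup>-\<^sup>1\<^sup>/\<^sup>2\<close> is continuous as well. The identities are inherited from the scalar powers.\<close>

lemma strictly_positive_square_roots:
  fixes A :: "'a::complex_hilbert op"
  assumes sa: "op_selfadjoint A" and "op_strict_pos A"
  shows "op_selfadjoint (op_powr A (1/2))" and "op_selfadjoint (op_powr A (-1/2))"
    and "op_powr A (1/2) o\<^sub>L op_powr A (1/2) = A"
    and "op_powr A (1/2) o\<^sub>L op_powr A (-1/2) = id_blinfun"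
    and "op_powr A (-1/2) o\<^sub>L op_powr A (1/2) = id_blinfun"
proof -
  obtain c where c: "0 < c" "\<And>x. c * (norm x)\<^sup>2 \<le> re_inner (A x) x"
    by (rule positive_op_invertible_imp_coercive[OF sa])
      (use assms in \<open>auto simp: op_strict_pos_def op_pos_iff\<close>)
  interpret selfadjoint_on_interval A c "norm A"
    by (rule selfadjoint_on_interval.intro[OF sa])
      (rule real_spectrum_subset_interval[OF op_selfadjointD(1)[OF sa] c(2) re_inner_apply_le])
  note cont = continuous_on_powr_interval[OF c(1)]
  have prod: "op_powr A r o\<^sub>L op_powr A r' = cfc (poly p) A"
    if "\<And>x. 0 < x \<Longrightarrow> x powr r * x powr r' = poly p x" for r r' p
  proof -
    have "op_powr A r o\<^sub>L op_powr A r' = cfc (\<lambda>x. x powr r * x powr r') A"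
      unfolding op_powr_def by (rule cfc_mult[OF cont cont, symmetric])
    also have "\<dots> = cfc (poly p) A"
    proof (rule cfc_cong)
      fix x assume "x \<in> real_spectrum A"
      then have "0 < x" using spectrum c(1) by force
      then show "x powr r * x powr r' = poly p x" by (rule that)
    qed
    finally show ?thesis .
  qed
  show "op_selfadjoint (op_powr A (1/2))" "op_selfadjoint (op_powr A (-1/2))"
    unfolding op_powr_def by (rule op_selfadjoint_cfc[OF cont])+
  show "op_powr A (1/2) o\<^sub>L op_powr A (1/2) = A"
    by (subst prod[where p = "[:0, 1:]"])
      (simp_all add: cfc_poly[OF sa] op_poly_linear flip: powr_add del: poly_pCons, simp)
  show "op_powr A (1/2) o\<^sub>L op_powr A (-1/2) = id_blinfun"
    by (subst prod[where p = "[:1:]"])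
      (simp_all add: cfc_poly[OF sa] op_poly_const flip: powr_add del: poly_pCons, simp)
  show "op_powr A (-1/2) o\<^sub>L op_powr A (1/2) = id_blinfun"
    by (subst prod[where p = "[:1:]"])
      (simp_all add: cfc_poly[OF sa] op_poly_const flip: powr_add del: poly_pCons, simp)
qed

text \<open>A scalar inequality between \<open>x\<^sup>v\<close> and \<open>(1 - v) + v x\<close> on \<open>[s, t]\<close> turns into one between the
  means: with \<open>C = A\<^sup>-\<^sup>1\<^sup>/\<^sup>2 B A\<^sup>-\<^sup>1\<^sup>/\<^sup>2\<close>, whose spectrum lies in \<open>[s, t]\<close>, conjugation by \<open>A\<^sup>1\<^sup>/\<^sup>2\<close> maps
  \<open>C\<^sup>v\<close> to the geometric mean and \<open>(1 - v) + v C\<close> to the arithmetic one.\<close>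

lemma mean_comparison:
  fixes A B :: "'a::complex_hilbert op"
  assumes A: "op_strict_pos A" and "0 < s"
    and sAB: "s *\<^sub>R A \<preceq> B" and BtA: "B \<preceq> t *\<^sub>R A"
  shows "(\<And>x. s \<le> x \<Longrightarrow> x \<le> t \<Longrightarrow> c * x powr v \<le> (1 - v) + v * x)
      \<Longrightarrow> c *\<^sub>R geom_mean v A B \<preceq> arith_mean v A B"
    and "(\<And>x. s \<le> x \<Longrightarrow> x \<le> t \<Longrightarrow> (1 - v) + v * x \<le> c * x powr v)
      \<Longrightarrow> arith_mean v A B \<preceq> c *\<^sub>R geom_mean v A B"
proof -
  have saB: "op_selfadjoint B" using sAB by (simp add: op_le_def)
  have "op_selfadjoint (s *\<^sub>R A)" using sAB by (simp add: op_le_def)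
  then have "op_selfadjoint ((1 / s) *\<^sub>R s *\<^sub>R A)" by (rule op_selfadjoint_scaleR)
  then have saA: "op_selfadjoint A" using \<open>0 < s\<close> by simp
  define H where "H = op_powr A (1/2)"
  define K where "K = op_powr A (-1/2)"
  note roots = strictly_positive_square_roots[OF saA A, folded H_def K_def]
  have HH: "H (H x) = A x" and HK: "H (K x) = x" and KH: "K (H x) = x" for x
    using roots by (metis blinfun_apply_blinfun_compose blinfun_apply_id_blinfun id_apply)+
  define C where "C = K o\<^sub>L B o\<^sub>L K"
  have saC: "op_selfadjoint C"
    unfolding C_def by (rule op_selfadjoint_conjugate[OF roots(2) saB])
  have formC: "re_inner (C x) x = re_inner (B (K x)) (K x)" for x
    by (simp add: C_def op_selfadjointD(2)[OF roots(2)])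
  have formA: "re_inner (A (K x)) (K x) = (norm x)\<^sup>2" for x
    by (metis HH HK op_selfadjointD(2)[OF roots(1)] re_inner_self)
  interpret selfadjoint_on_interval C s t
  proof
    show "real_spectrum C \<subseteq> {s..t}"
    proof (rule real_spectrum_subset_interval[OF op_selfadjointD(1)[OF saC]])
      fix x
      show "s * (norm x)\<^sup>2 \<le> re_inner (C x) x"
        using sAB op_le_iff[OF op_selfadjoint_scaleR[OF saA] saB]
        by (simp add: formC blinfun.scaleR_left re_inner.scaleR_left flip: formA)
      show "re_inner (C x) x \<le> t * (norm x)\<^sup>2"
        using BtA op_le_iff[OF saB op_selfadjoint_scaleR[OF saA]]
        by (simp add: formC blinfun.scaleR_left re_inner.scaleR_left flip: formA)
    qed
  qed (rule saC)
  have cont: "continuous_on {s..t} (\<lambda>x. c * x powr v)"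
    by (intro continuous_intros continuous_on_powr_interval[OF \<open>0 < s\<close>])
  have contp: "continuous_on {s..t} (poly [:1 - v, v:])"
    by (intro continuous_intros)
  have geom: "c *\<^sub>R geom_mean v A B = H o\<^sub>L cfc (\<lambda>x. c * x powr v) C o\<^sub>L H"
    unfolding cfc_scaleR[OF continuous_on_powr_interval[OF \<open>0 < s\<close>]] geom_mean_def
      H_def[symmetric] K_def[symmetric] C_def[symmetric] op_powr_def[of C]
    by (rule blinfun_eqI) (simp add: blinfun.scaleR_left blinfun.scaleR_right)
  have arith: "arith_mean v A B = H o\<^sub>L cfc (poly [:1 - v, v:]) C o\<^sub>L H"
    unfolding cfc_poly[OF saC] op_poly_linear arith_mean_def
    by (rule blinfun_eqI) (simp add: blinfun.bilinear_simps HH HK KH C_def)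
  have sa: "op_selfadjoint (c *\<^sub>R geom_mean v A B)" "op_selfadjoint (arith_mean v A B)"
    unfolding geom arith
    by (intro op_selfadjoint_conjugate roots op_selfadjoint_cfc cont contp)+
  have form: "re_inner ((H o\<^sub>L Y o\<^sub>L H) x) x = re_inner (Y (H x)) (H x)" for Y x
    by (simp add: op_selfadjointD(2)[OF roots(1)])
  show "c *\<^sub>R geom_mean v A B \<preceq> arith_mean v A B"
    if "\<And>x. s \<le> x \<Longrightarrow> x \<le> t \<Longrightarrow> c * x powr v \<le> (1 - v) + v * x"
    unfolding op_le_iff[OF sa] unfolding geom arith form
    using that by (intro allI cfc_mono[OF cont contp]) (simp add: mult.commute)
  show "arith_mean v A B \<preceq> c *\<^sub>R geom_mean v A B"
    if "\<And>x. s \<le> x \<Longrightarrow> x \<le> t \<Longrightarrow> (1 - v) + v * x \<le> c * x powr v"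
    unfolding op_le_iff[OF sa(2,1)] unfolding geom arith form
    using that by (intro allI cfc_mono[OF contp cont]) (simp add: mult.commute)
qed

theorem theorem2p1:
  fixes A B :: "'a::complex_hilbert op" and s t v :: real
  assumes "op_strict_pos A" and "op_strict_pos B"
    and "0 < s" and "s \<le> t"
    and "s *\<^sub>R A \<preceq> B" and "B \<preceq> t *\<^sub>R A"
    and "0 \<le> v" and "v \<le> 1"
  shows "(t \<le> 1 \<longrightarrow>
            fv v t *\<^sub>R geom_mean v A B \<preceq> arith_mean v A B \<and>
            arith_mean v A B \<preceq> fv v s *\<^sub>R geom_mean v A B) \<and>
         (1 \<le> s \<longrightarrow>
            fv v s *\<^sub>R geom_mean v A B \<preceq> arith_mean v A B \<and>
            arith_mean v A B \<preceq> fv v t *\<^sub>R geom_mean v A B)"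
proof -
  have lower: "c *\<^sub>R geom_mean v A B \<preceq> arith_mean v A B"
    if "\<And>x. s \<le> x \<Longrightarrow> x \<le> t \<Longrightarrow> c \<le> fv v x" for c
  proof (rule mean_comparison(1)[OF assms(1,3,5,6)])
    fix x assume x: "s \<le> x" "x \<le> t"
    then have "0 < x powr v" using \<open>0 < s\<close> by simp
    then show "c * x powr v \<le> (1 - v) + v * x"
      using that[OF x] by (simp add: fv_def pos_le_divide_eq)
  qed
  have upper: "arith_mean v A B \<preceq> c *\<^sub>R geom_mean v A B"
    if "\<And>x. s \<le> x \<Longrightarrow> x \<le> t \<Longrightarrow> fv v x \<le> c" for c
  proof (rule mean_comparison(2)[OF assms(1,3,5,6)])
    fix x assume x: "s \<le> x" "x \<le> t"
    then have "0 < x powr v" using \<open>0 < s\<close> by simp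
    then show "(1 - v) + v * x \<le> c * x powr v"
      using that[OF x] by (simp add: fv_def pos_divide_le_eq)
  qed
  show ?thesis
    using assms(3,4,7,8)
    by (intro conjI impI lower upper) (auto intro: fv_antimono fv_mono)
qed

end
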